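(* Let $k$ be a commutative ring, let $A$, $B$, $C$ be $k$-modules, and let $f:A\times B\to C$ be a $k$-bilinear map which is nondegenerate, in the sense that for every nonzero $a\in A$ the induced map $f(a,-):B\to C$ is nonzero, and for every nonzero $b\in B$ the induced map $f(-,b):A\to C$ is nonzero. If $A$ and $B$ are Artinian $k$-modules, then $A$ and $B$ both have finite length as $k$-modules.
   Context: Rings are associative and unital. *)

theory Defs
  imports "HOL-Algebra.Module"
begin

definition linear_maps ::
    "('r, 'x) ring_scheme \<Rightarrow> ('r, 'a, 'y) module_scheme \<Rightarrow> ('r, 'b, 'z) module_scheme \<Rightarrow> ('a \<Rightarrow> 'b) set"
  where "linear_maps R M N =
    {g. g \<in> carrier M \<rightarrow> carrier N \<and>
        (\<forall>x\<in>carrier M. \<forall>y\<in>carrier M. g (x \<oplus>\<^bsub>M\<^esub> y) = g x \<oplus>\<^bsub>N\<^esub> g y) \<and>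
        (\<forall>r\<in>carrier R. \<forall>x\<in>carrier M. g (r \<odot>\<^bsub>M\<^esub> x) = r \<odot>\<^bsub>N\<^esub> g x)}"

definition bilinear_map ::
    "('r, 'x) ring_scheme \<Rightarrow> ('r, 'a, 'y) module_scheme \<Rightarrow> ('r, 'b, 'z) module_scheme \<Rightarrow>
     ('r, 'c, 'w) module_scheme \<Rightarrow> ('a \<Rightarrow> 'b \<Rightarrow> 'c) \<Rightarrow> bool"
  where "bilinear_map R A B C f \<longleftrightarrow>
    (\<forall>a\<in>carrier A. f a \<in> linear_maps R B C) \<and>
    (\<forall>b\<in>carrier B. (\<lambda>a. f a b) \<in> linear_maps R A C)"

definition nondegenerate ::
    "('r, 'a, 'y) module_scheme \<Rightarrow> ('r, 'b, 'z) module_scheme \<Rightarrow>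
     ('r, 'c, 'w) module_scheme \<Rightarrow> ('a \<Rightarrow> 'b \<Rightarrow> 'c) \<Rightarrow> bool"
  where "nondegenerate A B C f \<longleftrightarrow>
    (\<forall>a\<in>carrier A. a \<noteq> \<zero>\<^bsub>A\<^esub> \<longrightarrow> (\<exists>b\<in>carrier B. f a b \<noteq> \<zero>\<^bsub>C\<^esub>)) \<and>
    (\<forall>b\<in>carrier B. b \<noteq> \<zero>\<^bsub>B\<^esub> \<longrightarrow> (\<exists>a\<in>carrier A. f a b \<noteq> \<zero>\<^bsub>C\<^esub>))"

definition artinian_module :: "('r, 'x) ring_scheme \<Rightarrow> ('r, 'a, 'y) module_scheme \<Rightarrow> bool"
  where "artinian_module R M \<longleftrightarrow> module R M \<and>
    (\<forall>N :: nat \<Rightarrow> 'a set.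
       (\<forall>i. submodule (N i) R M) \<and> (\<forall>i. N (Suc i) \<subseteq> N i) \<longrightarrow>
       (\<exists>n. \<forall>m\<ge>n. N m = N n))"

(* A composition series is a finite strict chain of submodules from 0 to M into which no further
   submodule can be inserted, i.e. one with simple factors. The zero module has the
   series of length n = 0. *)
definition composition_series ::
    "('r, 'x) ring_scheme \<Rightarrow> ('r, 'a, 'y) module_scheme \<Rightarrow> nat \<Rightarrow> (nat \<Rightarrow> 'a set) \<Rightarrow> bool"
  where "composition_series R M n N \<longleftrightarrow>
    N 0 = {\<zero>\<^bsub>M\<^esub>} \<and> N n = carrier M \<and>
    (\<forall>i\<le>n. submodule (N i) R M) \<and>
    (\<forall>i<n. N i \<subset> N (Suc i) \<and>
       \<not> (\<exists>K. submodule K R M \<and> N i \<subset> K \<and> K \<subset> N (Suc i)))"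

definition finite_length :: "('r, 'x) ring_scheme \<Rightarrow> ('r, 'a, 'y) module_scheme \<Rightarrow> bool"
  where "finite_length R M \<longleftrightarrow> module R M \<and> (\<exists>n N. composition_series R M n N)"

end

theory Submission
  imports Defs
begin

text \<open>
  Exchanging the arguments of the pairing exchanges \<open>A\<close> and \<open>B\<close>, so it is enough to treat \<open>A\<close>. The
  hypothesis on the pairing enters as the fact that only \<open>a = 0\<close> pairs to zero with all of \<open>B\<close>.

  Suppose that \<open>A\<close> has infinite length. As \<open>A\<close> is Artinian, it has a submodule \<open>N\<close> that is minimal
  among those of infinite length. A scalar \<open>r\<close> then either annihilates \<open>N\<close> or maps it onto
  itself: otherwise \<open>r N\<close> and the kernel of \<open>r\<close> on \<open>N\<close> are both proper submodules of \<open>N\<close>, hence of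
  finite length, and then so is \<open>N\<close> (\<open>finite_length_from_scaling\<close>).

  The pairing shows that a scalar with \<open>r N = N\<close> is moreover injective on \<open>N\<close>
  (\<open>divisible_imp_torsion_free\<close>): divisibility lets one move arbitrarily high powers of \<open>r\<close> to the
  second argument, where the chain of the \<open>r\<^sup>n B\<close> is stationary. So every scalar acts on \<open>N\<close> as
  zero or bijectively. Since \<open>N\<close> contains a minimal nonzero submodule, the nonzero actions even have
  inverses among the scalars (\<open>scalars_act_as_field\<close>), that is, \<open>N\<close> is a vector space over a residue
  field of the base ring. Finally, a vector space \<open>N\<close> has a maximal proper subspace
  (\<open>exists_maximal_submodule\<close>). That one has finite length by the choice of \<open>N\<close>, and so \<open>N\<close> has
  finite length too, a contradiction.
\<close>

section \<open>Composition series as chains of covers\<close>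

definition submodule_cover ::
    "('r, 'x) ring_scheme \<Rightarrow> ('r, 'a, 'y) module_scheme \<Rightarrow> 'a set \<Rightarrow> 'a set \<Rightarrow> bool"
  where "submodule_cover R M X Y \<longleftrightarrow> submodule X R M \<and> submodule Y R M \<and> X \<subset> Y \<and>
    \<not> (\<exists>K. submodule K R M \<and> X \<subset> K \<and> K \<subset> Y)"

text \<open>Finite length of a submodule, expressed in the submodule lattice of the ambient module, so
  that no submodule ever has to be made into a module of its own.\<close>

definition finite_length_submodule ::
    "('r, 'x) ring_scheme \<Rightarrow> ('r, 'a, 'y) module_scheme \<Rightarrow> 'a set \<Rightarrow> bool"
  where "finite_length_submodule R M N \<longleftrightarrow> (submodule_cover R M)\<^sup>*\<^sup>* {\<zero>\<^bsub>M\<^esub>} N"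

context module
begin

lemma submoduleI':
  assumes "H \<subseteq> carrier M" "\<zero>\<^bsub>M\<^esub> \<in> H"
    and "\<And>x y. x \<in> H \<Longrightarrow> y \<in> H \<Longrightarrow> x \<oplus>\<^bsub>M\<^esub> y \<in> H"
    and "\<And>r x. r \<in> carrier R \<Longrightarrow> x \<in> H \<Longrightarrow> r \<odot>\<^bsub>M\<^esub> x \<in> H"
  shows "submodule H R M"
proof (rule submoduleI)
  fix x assume x: "x \<in> H"
  with assms(1) have "\<ominus>\<^bsub>M\<^esub> x = (\<ominus> \<one>) \<odot>\<^bsub>M\<^esub> x"
    by (simp add: smult_l_minus subset_iff)
  with x assms(4) show "\<ominus>\<^bsub>M\<^esub> x \<in> H" by simp
qed (use assms in auto)

lemma submodule_zero_mem: "submodule H R M \<Longrightarrow> \<zero>\<^bsub>M\<^esub> \<in> H"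
  using subgroup.one_closed[of H "add_monoid M"] by (simp add: submodule_def)

lemma zero_submodule: "submodule {\<zero>\<^bsub>M\<^esub>} R M"
  by (rule submoduleI') auto

lemma submodule_image:
  assumes "r \<in> carrier R" "submodule N R M"
  shows "submodule ((\<lambda>x. r \<odot>\<^bsub>M\<^esub> x) ` N) R M"
proof (rule submoduleI')
  note N = submoduleE[OF assms(2)]
  have NM: "x \<in> carrier M" if "x \<in> N" for x using that N(1) by blast
  show "(\<lambda>x. r \<odot>\<^bsub>M\<^esub> x) ` N \<subseteq> carrier M" using assms(1) NM by auto
  show "\<zero>\<^bsub>M\<^esub> \<in> (\<lambda>x. r \<odot>\<^bsub>M\<^esub> x) ` N"
    using submodule_zero_mem[OF assms(2)] assms(1) by (intro image_eqI[of _ _ "\<zero>\<^bsub>M\<^esub>"]) auto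
  fix x y assume "x \<in> (\<lambda>x. r \<odot>\<^bsub>M\<^esub> x) ` N" "y \<in> (\<lambda>x. r \<odot>\<^bsub>M\<^esub> x) ` N"
  then obtain x' y' where "x' \<in> N" "y' \<in> N" "x = r \<odot>\<^bsub>M\<^esub> x'" "y = r \<odot>\<^bsub>M\<^esub> y'" by blast
  then show "x \<oplus>\<^bsub>M\<^esub> y \<in> (\<lambda>x. r \<odot>\<^bsub>M\<^esub> x) ` N"
    using assms(1) NM N(5) by (intro image_eqI[of _ _ "x' \<oplus>\<^bsub>M\<^esub> y'"]) (auto simp: smult_r_distr)
next
  note N = submoduleE[OF assms(2)]
  have NM: "x \<in> carrier M" if "x \<in> N" for x using that N(1) by blast
  fix s x assume s: "s \<in> carrier R" and "x \<in> (\<lambda>x. r \<odot>\<^bsub>M\<^esub> x) ` N"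
  then obtain x' where x': "x' \<in> N" "x = r \<odot>\<^bsub>M\<^esub> x'" by blast
  then have "s \<odot>\<^bsub>M\<^esub> x = r \<odot>\<^bsub>M\<^esub> (s \<odot>\<^bsub>M\<^esub> x')"
    using assms(1) s NM by (metis R.m_comm smult_assoc1)
  then show "s \<odot>\<^bsub>M\<^esub> x \<in> (\<lambda>x. r \<odot>\<^bsub>M\<^esub> x) ` N" using s x' N(4) by blast
qed

lemma submodule_preimage:
  assumes "r \<in> carrier R" "submodule N R M" "submodule U R M"
  shows "submodule {x \<in> N. r \<odot>\<^bsub>M\<^esub> x \<in> U} R M"
proof (rule submoduleI')
  note N = submoduleE[OF assms(2)] and U = submoduleE[OF assms(3)]
  have NM: "x \<in> carrier M" if "x \<in> N" for x using that N(1) by blast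
  show "{x \<in> N. r \<odot>\<^bsub>M\<^esub> x \<in> U} \<subseteq> carrier M" using NM by auto
  show "\<zero>\<^bsub>M\<^esub> \<in> {x \<in> N. r \<odot>\<^bsub>M\<^esub> x \<in> U}"
    using assms by (simp add: submodule_zero_mem)
  show "x \<oplus>\<^bsub>M\<^esub> y \<in> {x \<in> N. r \<odot>\<^bsub>M\<^esub> x \<in> U}"
    if "x \<in> {x \<in> N. r \<odot>\<^bsub>M\<^esub> x \<in> U}" "y \<in> {x \<in> N. r \<odot>\<^bsub>M\<^esub> x \<in> U}" for x y
    using that assms(1) NM N(5) U(5) by (simp add: smult_r_distr)
  show "s \<odot>\<^bsub>M\<^esub> x \<in> {x \<in> N. r \<odot>\<^bsub>M\<^esub> x \<in> U}"
    if s: "s \<in> carrier R" and x: "x \<in> {x \<in> N. r \<odot>\<^bsub>M\<^esub> x \<in> U}" for s x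
  proof -
    have "r \<odot>\<^bsub>M\<^esub> (s \<odot>\<^bsub>M\<^esub> x) = s \<odot>\<^bsub>M\<^esub> (r \<odot>\<^bsub>M\<^esub> x)"
      using assms(1) s x NM by (metis (mono_tags, lifting) R.m_comm mem_Collect_eq smult_assoc1)
    then show ?thesis using s x N(4) U(4) by simp
  qed
qed

lemma submodule_Union_chain:
  assumes "\<C> \<noteq> {}" "subset.chain {K. submodule K R M} \<C>"
  shows "submodule (\<Union>\<C>) R M"
proof (rule submoduleI')
  have sub: "submodule K R M" if "K \<in> \<C>" for K
    using assms(2) that by (auto simp: subset.chain_def)
  show "\<Union>\<C> \<subseteq> carrier M" using sub submoduleE(1) by blast
  show "\<zero>\<^bsub>M\<^esub> \<in> \<Union>\<C>" using assms(1) sub submodule_zero_mem by blast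
  show "r \<odot>\<^bsub>M\<^esub> x \<in> \<Union>\<C>" if "r \<in> carrier R" "x \<in> \<Union>\<C>" for r x
    using that sub submoduleE(4) by blast
  show "x \<oplus>\<^bsub>M\<^esub> y \<in> \<Union>\<C>" if "x \<in> \<Union>\<C>" "y \<in> \<Union>\<C>" for x y
  proof -
    obtain K L where KL: "K \<in> \<C>" "L \<in> \<C>" "x \<in> K" "y \<in> L" using \<open>x \<in> \<Union>\<C>\<close> \<open>y \<in> \<Union>\<C>\<close> by blast
    then have "K \<subseteq> L \<or> L \<subseteq> K" using assms(2) by (auto simp: subset_chain_def)
    then show ?thesis using KL sub submoduleE(5) by (meson UnionI subsetD)
  qed
qed

lemma submodule_add_multiples:
  assumes "submodule N R M" "x \<in> carrier M"
  shows "submodule {m \<oplus>\<^bsub>M\<^esub> s \<odot>\<^bsub>M\<^esub> x | m s. m \<in> N \<and> s \<in> carrier R} R M" (is "submodule ?H R M")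
proof (rule submoduleI')
  note N = submoduleE[OF assms(1)]
  have NM: "m \<in> carrier M" if "m \<in> N" for m using that N(1) by blast
  show "?H \<subseteq> carrier M" using NM assms(2) by auto
  show "\<zero>\<^bsub>M\<^esub> \<in> ?H"
    using submodule_zero_mem[OF assms(1)] assms(2)
    by (intro CollectI exI[of _ "\<zero>\<^bsub>M\<^esub>"] exI[of _ "\<zero>"]) auto
  show "u \<oplus>\<^bsub>M\<^esub> v \<in> ?H" if uv: "u \<in> ?H" "v \<in> ?H" for u v
  proof -
    obtain m s n t where *: "m \<in> N" "n \<in> N" "s \<in> carrier R" "t \<in> carrier R"
      "u = m \<oplus>\<^bsub>M\<^esub> s \<odot>\<^bsub>M\<^esub> x" "v = n \<oplus>\<^bsub>M\<^esub> t \<odot>\<^bsub>M\<^esub> x" using uv by blast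
    then have "u \<oplus>\<^bsub>M\<^esub> v = (m \<oplus>\<^bsub>M\<^esub> n) \<oplus>\<^bsub>M\<^esub> (s \<oplus> t) \<odot>\<^bsub>M\<^esub> x"
      using NM assms(2) by (simp add: smult_l_distr M.a_ac)
    then show ?thesis using * N(5) R.a_closed by blast
  qed
  show "r \<odot>\<^bsub>M\<^esub> u \<in> ?H" if ru: "r \<in> carrier R" "u \<in> ?H" for r u
  proof -
    obtain m s where *: "m \<in> N" "s \<in> carrier R" "u = m \<oplus>\<^bsub>M\<^esub> s \<odot>\<^bsub>M\<^esub> x" using ru by blast
    then have "r \<odot>\<^bsub>M\<^esub> u = r \<odot>\<^bsub>M\<^esub> m \<oplus>\<^bsub>M\<^esub> (r \<otimes> s) \<odot>\<^bsub>M\<^esub> x"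
      using NM ru assms(2) by (simp add: smult_r_distr smult_assoc1)
    then show ?thesis using * ru N(4) R.m_closed by blast
  qed
qed

lemma finite_length_iff:
  "finite_length R M \<longleftrightarrow> finite_length_submodule R M (carrier M)"
proof -
  have "composition_series R M n F \<longleftrightarrow>
      F 0 = {\<zero>\<^bsub>M\<^esub>} \<and> F n = carrier M \<and> (\<forall>i<n. submodule_cover R M (F i) (F (Suc i)))" for n F
  proof
    assume "composition_series R M n F"
    then show "F 0 = {\<zero>\<^bsub>M\<^esub>} \<and> F n = carrier M \<and> (\<forall>i<n. submodule_cover R M (F i) (F (Suc i)))"
      by (auto simp: composition_series_def submodule_cover_def)
  next
    assume *: "F 0 = {\<zero>\<^bsub>M\<^esub>} \<and> F n = carrier M \<and> (\<forall>i<n. submodule_cover R M (F i) (F (Suc i)))"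
    have "submodule (F i) R M" if "i \<le> n" for i
    proof (cases "i = n")
      case True then show ?thesis using * carrier_is_submodule by simp
    next
      case False then show ?thesis using that * by (auto simp: submodule_cover_def)
    qed
    then show "composition_series R M n F"
      using * unfolding composition_series_def submodule_cover_def by blast
  qed
  then show ?thesis
    unfolding finite_length_def finite_length_submodule_def rtranclp_power relpowp_fun_conv
    using module_axioms by blast
qed

lemma finite_length_submodule_cover:
  "finite_length_submodule R M X \<Longrightarrow> submodule_cover R M X Y \<Longrightarrow> finite_length_submodule R M Y"
  unfolding finite_length_submodule_def by (rule rtranclp.rtrancl_into_rtrancl)

text \<open>Preimages under a surjection embed the submodule lattice of the target as an upper interval
  of that of the source. Here the surjection is multiplication by \<open>r\<close> from \<open>N\<close> onto \<open>r N\<close>.\<close>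

lemma submodule_cover_preimage:
  assumes r: "r \<in> carrier R" and N: "submodule N R M"
    and UV: "submodule_cover R M U V" and V: "V \<subseteq> (\<lambda>x. r \<odot>\<^bsub>M\<^esub> x) ` N"
  shows "submodule_cover R M {x \<in> N. r \<odot>\<^bsub>M\<^esub> x \<in> U} {x \<in> N. r \<odot>\<^bsub>M\<^esub> x \<in> V}"
proof -
  let ?pre = "\<lambda>U. {x \<in> N. r \<odot>\<^bsub>M\<^esub> x \<in> U}"
  have U: "submodule U R M" "submodule V R M" "U \<subset> V"
    and nb: "\<And>K. submodule K R M \<Longrightarrow> U \<subset> K \<Longrightarrow> K \<subset> V \<Longrightarrow> False"
    using UV by (auto simp: submodule_cover_def)
  have "False" if K: "submodule K R M" "?pre U \<subset> K" "K \<subset> ?pre V" for K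
  proof -
    let ?L = "(\<lambda>x. r \<odot>\<^bsub>M\<^esub> x) ` K"
    have L: "submodule ?L R M" using submodule_image[OF r K(1)] .
    have "U \<subseteq> ?L"
    proof
      fix u assume u: "u \<in> U"
      then obtain x where "x \<in> N" "u = r \<odot>\<^bsub>M\<^esub> x" using U V by blast
      then show "u \<in> ?L" using u K(2) by blast
    qed
    moreover have "?L \<noteq> U" using K(2,3) by blast
    moreover have "?L \<subseteq> V" using K(3) by blast
    moreover have "?L \<noteq> V"
    proof
      assume LV: "?L = V"
      \<comment> \<open>\<open>K\<close> contains the kernel, hence is the full preimage of its image.\<close>
      have "?pre V \<subseteq> K"
      proof
        fix x assume x: "x \<in> ?pre V"
        then obtain y where y: "y \<in> K" "r \<odot>\<^bsub>M\<^esub> x = r \<odot>\<^bsub>M\<^esub> y" using LV by blast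
        have yN: "y \<in> N" using y K(3) by blast
        have car: "x \<in> carrier M" "y \<in> carrier M" using x yN submoduleE(1)[OF N] by auto
        have "r \<odot>\<^bsub>M\<^esub> (x \<oplus>\<^bsub>M\<^esub> \<ominus>\<^bsub>M\<^esub> y) = \<zero>\<^bsub>M\<^esub>"
          using car r y by (simp add: smult_r_distr smult_r_minus M.r_neg)
        moreover have "x \<oplus>\<^bsub>M\<^esub> \<ominus>\<^bsub>M\<^esub> y \<in> N" using x yN submoduleE(3,5)[OF N] by simp
        ultimately have "x \<oplus>\<^bsub>M\<^esub> \<ominus>\<^bsub>M\<^esub> y \<in> K" using K(2) submodule_zero_mem[OF U(1)] by auto
        then have "(x \<oplus>\<^bsub>M\<^esub> \<ominus>\<^bsub>M\<^esub> y) \<oplus>\<^bsub>M\<^esub> y \<in> K" using y submoduleE(5)[OF K(1)] by blast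
        then show "x \<in> K" using car by (simp add: M.a_assoc M.l_neg)
      qed
      then show False using K(3) by blast
    qed
    ultimately show False using nb[OF L] by blast
  qed
  moreover have "?pre U \<subset> ?pre V"
  proof -
    obtain v where v: "v \<in> V" "v \<notin> U" using U(3) by blast
    then obtain x where "x \<in> N" "v = r \<odot>\<^bsub>M\<^esub> x" using V by blast
    then show ?thesis using v U(3) by blast
  qed
  ultimately show ?thesis
    using submodule_preimage[OF r N] U unfolding submodule_cover_def by blast
qed

text \<open>Additivity of length for \<open>0 \<rightarrow> ker r \<rightarrow> N \<rightarrow> r N \<rightarrow> 0\<close>: a composition series of the kernel is
  continued by the preimages of a composition series of the image.\<close>

lemma finite_length_from_scaling:
  assumes r: "r \<in> carrier R" and N: "submodule N R M"
    and ker: "finite_length_submodule R M {x \<in> N. r \<odot>\<^bsub>M\<^esub> x = \<zero>\<^bsub>M\<^esub>}"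
    and im: "finite_length_submodule R M ((\<lambda>x. r \<odot>\<^bsub>M\<^esub> x) ` N)"
  shows "finite_length_submodule R M N"
proof -
  have "V \<subseteq> (\<lambda>x. r \<odot>\<^bsub>M\<^esub> x) ` N \<longrightarrow> finite_length_submodule R M {x \<in> N. r \<odot>\<^bsub>M\<^esub> x \<in> V}"
    if "(submodule_cover R M)\<^sup>*\<^sup>* {\<zero>\<^bsub>M\<^esub>} V" for V
    using that
  proof (induction rule: rtranclp_induct)
    case base
    then show ?case using ker by simp
  next
    case (step V W)
    then have "V \<subseteq> W" by (auto simp: submodule_cover_def)
    then show ?case
      using step submodule_cover_preimage[OF r N] finite_length_submodule_cover by blast
  qed
  from this[of "(\<lambda>x. r \<odot>\<^bsub>M\<^esub> x) ` N"] im
  have "finite_length_submodule R M {x \<in> N. r \<odot>\<^bsub>M\<^esub> x \<in> (\<lambda>x. r \<odot>\<^bsub>M\<^esub> x) ` N}"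
    by (simp add: finite_length_submodule_def)
  moreover have "{x \<in> N. r \<odot>\<^bsub>M\<^esub> x \<in> (\<lambda>x. r \<odot>\<^bsub>M\<^esub> x) ` N} = N" by blast
  ultimately show ?thesis by simp
qed

section \<open>Modules on which scalars act as zero or invertibly\<close>

lemma artinian_minimal:
  assumes art: "artinian_module R M" and "submodule N\<^sub>0 R M" "P N\<^sub>0"
  obtains N where "submodule N R M" "P N"
    "\<And>K. submodule K R M \<Longrightarrow> K \<subset> N \<Longrightarrow> \<not> P K"
proof (rule ccontr)
  assume "\<not> thesis"
  then have "\<forall>N. submodule N R M \<and> P N \<longrightarrow> (\<exists>K. (submodule K R M \<and> P K) \<and> K \<subset> N)"
    using that by blast
  then have "\<exists>F :: nat \<Rightarrow> 'c set. \<forall>i. (submodule (F i) R M \<and> P (F i)) \<and> F (Suc i) \<subset> F i"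
    using assms(2,3)
    by (intro dependent_nat_choice[where P = "\<lambda>_ K. submodule K R M \<and> P K"
          and Q = "\<lambda>_ N K. K \<subset> N"]) blast+
  then obtain F :: "nat \<Rightarrow> 'c set" where F: "\<And>i. submodule (F i) R M" "\<And>i. F (Suc i) \<subset> F i" by blast
  then obtain n where n: "\<forall>m\<ge>n. F m = F n"
    using art unfolding artinian_module_def by blast
  have "F (Suc n) = F n" by (rule n[rule_format]) simp
  then show False using F(2) by blast
qed

text \<open>A minimal nonzero submodule of \<open>N\<close> is simple, and a simple module is a copy of a residue
  field \<open>R / m\<close>. So a scalar \<open>r\<close> that acts invertibly has an inverse \<open>c\<close> on it, whence \<open>c r - 1\<close> is
  not injective on \<open>N\<close>, and therefore acts as zero on all of \<open>N\<close>.\<close>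

lemma scalars_act_as_field:
  assumes art: "artinian_module R M" and N: "submodule N R M"
    and nz: "N \<noteq> {\<zero>\<^bsub>M\<^esub>}"
    and dich: "\<And>r x. \<lbrakk>r \<in> carrier R; x \<in> N; x \<noteq> \<zero>\<^bsub>M\<^esub>; r \<odot>\<^bsub>M\<^esub> x = \<zero>\<^bsub>M\<^esub>\<rbrakk>
               \<Longrightarrow> \<forall>y\<in>N. r \<odot>\<^bsub>M\<^esub> y = \<zero>\<^bsub>M\<^esub>"
    and r: "r \<in> carrier R" "\<not> (\<forall>y\<in>N. r \<odot>\<^bsub>M\<^esub> y = \<zero>\<^bsub>M\<^esub>)"
  shows "\<exists>c\<in>carrier R. \<forall>x\<in>N. c \<odot>\<^bsub>M\<^esub> (r \<odot>\<^bsub>M\<^esub> x) = x"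
proof -
  have NM: "x \<in> carrier M" if "x \<in> N" for x using that submoduleE(1)[OF N] by blast
  obtain S where S: "submodule S R M" "S \<subseteq> N \<and> S \<noteq> {\<zero>\<^bsub>M\<^esub>}"
    and Smin: "\<And>K. submodule K R M \<Longrightarrow> K \<subset> S \<Longrightarrow> \<not> (K \<subseteq> N \<and> K \<noteq> {\<zero>\<^bsub>M\<^esub>})"
    using artinian_minimal[OF art N, of "\<lambda>S. S \<subseteq> N \<and> S \<noteq> {\<zero>\<^bsub>M\<^esub>}"] nz by blast
  obtain a where a: "a \<in> S" "a \<noteq> \<zero>\<^bsub>M\<^esub>" using S(2) submodule_zero_mem[OF S(1)] by blast
  have aN: "a \<in> N" and aM: "a \<in> carrier M" using a S(2) NM by auto
  have ra0: "r \<odot>\<^bsub>M\<^esub> a \<noteq> \<zero>\<^bsub>M\<^esub>" using dich[OF r(1) aN a(2)] r(2) by blast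
  have raS: "r \<odot>\<^bsub>M\<^esub> a \<in> S" using submoduleE(4)[OF S(1) r(1) a(1)] .
  have raM: "r \<odot>\<^bsub>M\<^esub> a \<in> carrier M" using r(1) aM by simp
  let ?K = "{m \<oplus>\<^bsub>M\<^esub> s \<odot>\<^bsub>M\<^esub> (r \<odot>\<^bsub>M\<^esub> a) | m s. m \<in> {\<zero>\<^bsub>M\<^esub>} \<and> s \<in> carrier R}"
  have K: "submodule ?K R M" by (rule submodule_add_multiples[OF zero_submodule raM])
  have "?K \<subseteq> S"
  proof
    fix x assume "x \<in> ?K"
    then obtain s where s: "s \<in> carrier R" "x = \<zero>\<^bsub>M\<^esub> \<oplus>\<^bsub>M\<^esub> s \<odot>\<^bsub>M\<^esub> (r \<odot>\<^bsub>M\<^esub> a)" by blast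
    then show "x \<in> S"
      using submoduleE(4)[OF S(1) _ raS] submoduleE(5)[OF S(1) submodule_zero_mem[OF S(1)]] by blast
  qed
  moreover have "r \<odot>\<^bsub>M\<^esub> a \<in> ?K"
    using raM by (intro CollectI exI[of _ "\<zero>\<^bsub>M\<^esub>"] exI[of _ "\<one>"]) simp
  then have "?K \<noteq> {\<zero>\<^bsub>M\<^esub>}" using ra0 by blast
  ultimately have "?K = S" using Smin[OF K] S(2) by blast
  then obtain c where c: "c \<in> carrier R" "a = \<zero>\<^bsub>M\<^esub> \<oplus>\<^bsub>M\<^esub> c \<odot>\<^bsub>M\<^esub> (r \<odot>\<^bsub>M\<^esub> a)" using a(1) by blast
  have ca: "a = c \<odot>\<^bsub>M\<^esub> (r \<odot>\<^bsub>M\<^esub> a)" using c raM by simp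
  let ?d = "c \<otimes> r \<oplus> \<ominus> \<one>"
  have d: "?d \<odot>\<^bsub>M\<^esub> x = c \<odot>\<^bsub>M\<^esub> (r \<odot>\<^bsub>M\<^esub> x) \<oplus>\<^bsub>M\<^esub> \<ominus>\<^bsub>M\<^esub> x" if "x \<in> carrier M" for x
    using that c(1) r(1) by (simp add: smult_l_distr smult_l_minus smult_assoc1)
  have "?d \<odot>\<^bsub>M\<^esub> a = \<zero>\<^bsub>M\<^esub>" using d[OF aM] ca aM by (simp add: M.r_neg)
  then have "\<forall>y\<in>N. ?d \<odot>\<^bsub>M\<^esub> y = \<zero>\<^bsub>M\<^esub>" using dich[of ?d a] aN a(2) c(1) r(1) by simp
  then have "c \<odot>\<^bsub>M\<^esub> (r \<odot>\<^bsub>M\<^esub> x) = x" if "x \<in> N" for x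
    using that NM c(1) r(1) d[OF NM[OF that]]
    by (metis M.add.inv_closed M.minus_equality M.minus_minus smult_closed)
  then show ?thesis using c(1) by blast
qed

text \<open>A hyperplane: by Zorn's lemma there is a submodule \<open>K\<close> maximal subject to missing a given
  nonzero vector \<open>a\<close>. Any \<open>x\<close> outside \<open>K\<close> has \<open>a = m + s x\<close> with \<open>m\<close> in \<open>K\<close>, and inverting \<open>s\<close>
  shows \<open>N = K + R a\<close>.\<close>

lemma exists_maximal_submodule:
  assumes N: "submodule N R M" and nz: "N \<noteq> {\<zero>\<^bsub>M\<^esub>}"
    and field: "\<And>r. \<lbrakk>r \<in> carrier R; \<not> (\<forall>y\<in>N. r \<odot>\<^bsub>M\<^esub> y = \<zero>\<^bsub>M\<^esub>)\<rbrakk>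
                \<Longrightarrow> \<exists>c\<in>carrier R. \<forall>x\<in>N. c \<odot>\<^bsub>M\<^esub> (r \<odot>\<^bsub>M\<^esub> x) = x"
  obtains K where "submodule_cover R M K N"
proof -
  have NM: "x \<in> carrier M" if "x \<in> N" for x using that submoduleE(1)[OF N] by blast
  obtain a where a: "a \<in> N" "a \<noteq> \<zero>\<^bsub>M\<^esub>" using nz submodule_zero_mem[OF N] by blast
  let ?F = "{K. submodule K R M \<and> K \<subseteq> N \<and> a \<notin> K}"
  have "\<exists>K\<in>?F. \<forall>X\<in>?F. K \<subseteq> X \<longrightarrow> X = K"
  proof (rule subset_Zorn_nonempty)
    have "{\<zero>\<^bsub>M\<^esub>} \<in> ?F" using zero_submodule submodule_zero_mem[OF N] a by simp
    then show "?F \<noteq> {}" by blast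
    fix \<C> assume C: "\<C> \<noteq> {}" "subset.chain ?F \<C>"
    then have "subset.chain {K. submodule K R M} \<C>" by (auto simp: subset_chain_def)
    then have "submodule (\<Union>\<C>) R M" using C(1) submodule_Union_chain by blast
    then show "\<Union>\<C> \<in> ?F" using C(2) by (auto simp: subset_chain_def)
  qed
  then obtain K where KF: "K \<in> ?F" and max: "\<forall>X\<in>?F. K \<subseteq> X \<longrightarrow> X = K" by (rule bexE)
  from KF have K: "submodule K R M" "K \<subseteq> N" "a \<notin> K" by auto
  have Kmax: "a \<in> X" if "submodule X R M" "X \<subseteq> N" "K \<subset> X" for X
    using max that by blast
  have "N \<subseteq> X" if X: "submodule X R M" "K \<subset> X" "X \<subset> N" for X
  proof
    fix x assume x: "x \<in> N"
    have xM: "x \<in> carrier M" using NM x .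
    have aX: "a \<in> X" using Kmax X by blast
    show "x \<in> X"
    proof (cases "x \<in> K")
      case True then show ?thesis using X by blast
    next
      case False
      let ?H = "{m \<oplus>\<^bsub>M\<^esub> s \<odot>\<^bsub>M\<^esub> x | m s. m \<in> K \<and> s \<in> carrier R}"
      have H: "submodule ?H R M" by (rule submodule_add_multiples[OF K(1) xM])
      have "?H \<subseteq> N" using K(2) x submoduleE(4,5)[OF N] by blast
      moreover have "K \<subseteq> ?H"
      proof
        fix m assume m: "m \<in> K"
        then have "m = m \<oplus>\<^bsub>M\<^esub> \<zero> \<odot>\<^bsub>M\<^esub> x" using xM K(2) NM by auto
        then show "m \<in> ?H" using m by blast
      qed
      moreover have "x \<in> ?H"
        using xM submodule_zero_mem[OF K(1)]
        by (intro CollectI exI[of _ "\<zero>\<^bsub>M\<^esub>"] exI[of _ "\<one>"]) simp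
      ultimately have "a \<in> ?H" using Kmax[OF H] False by blast
      then obtain m s where ms: "m \<in> K" "s \<in> carrier R" "a = m \<oplus>\<^bsub>M\<^esub> s \<odot>\<^bsub>M\<^esub> x" by blast
      have mM: "m \<in> carrier M" using ms K(2) NM by blast
      have "\<not> (\<forall>y\<in>N. s \<odot>\<^bsub>M\<^esub> y = \<zero>\<^bsub>M\<^esub>)" using ms x K(3) mM M.r_zero by metis
      then obtain c where c: "c \<in> carrier R" "c \<odot>\<^bsub>M\<^esub> (s \<odot>\<^bsub>M\<^esub> x) = x" using field ms x by blast
      have "s \<odot>\<^bsub>M\<^esub> x = \<ominus>\<^bsub>M\<^esub> m \<oplus>\<^bsub>M\<^esub> a"
        using ms mM xM by (simp add: M.r_neg1)
      moreover have "\<ominus>\<^bsub>M\<^esub> m \<oplus>\<^bsub>M\<^esub> a \<in> X"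
        using ms X(2) aX submoduleE(3,5)[OF X(1)] by blast
      ultimately show ?thesis using c submoduleE(4)[OF X(1) c(1)] by metis
    qed
  qed
  then have "submodule_cover R M K N"
    using K N a unfolding submodule_cover_def by blast
  then show thesis using that by blast
qed

end

section \<open>Finite length from a pairing\<close>

text \<open>Given \<open>r a = 0\<close>, write \<open>a = r\<^sup>n a'\<close> with \<open>n\<close> so large that \<open>r\<^sup>n B = r\<^sup>n\<^sup>+\<^sup>1 B\<close>. For any \<open>b\<close> there is then
  \<open>b'\<close> with \<open>r\<^sup>n b = r\<^sup>n\<^sup>+\<^sup>1 b'\<close>, and
  \<open>f(a, b) = f(a', r\<^sup>n b) = f(a', r\<^sup>n\<^sup>+\<^sup>1 b') = f(r a, b') = 0\<close>.\<close>

lemma divisible_imp_torsion_free: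
  fixes k :: "('r, 'x) ring_scheme"
    and A :: "('r, 'a, 'y) module_scheme"
    and B :: "('r, 'b, 'z) module_scheme"
    and C :: "('r, 'c, 'w) module_scheme"
  assumes "module k A" "module k C"
    and bil: "bilinear_map k A B C f"
    and nondeg: "\<forall>a\<in>carrier A. a \<noteq> \<zero>\<^bsub>A\<^esub> \<longrightarrow> (\<exists>b\<in>carrier B. f a b \<noteq> \<zero>\<^bsub>C\<^esub>)"
    and art: "artinian_module k B"
    and N: "N \<subseteq> carrier A"
    and r: "r \<in> carrier k" and div: "(\<lambda>x. r \<odot>\<^bsub>A\<^esub> x) ` N = N"
    and a: "a \<in> N" "r \<odot>\<^bsub>A\<^esub> a = \<zero>\<^bsub>A\<^esub>"
  shows "a = \<zero>\<^bsub>A\<^esub>"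
proof -
  interpret A: module k A by fact
  interpret B: module k B using art by (simp add: artinian_module_def)
  interpret C: module k C by fact
  have NA: "x \<in> carrier A" if "x \<in> N" for x using that N by blast
  have fC: "f x y \<in> carrier C" if "x \<in> carrier A" "y \<in> carrier B" for x y
    using bil that by (auto simp: bilinear_map_def linear_maps_def)
  have swap: "f (s \<odot>\<^bsub>A\<^esub> x) y = f x (s \<odot>\<^bsub>B\<^esub> y)"
    if "s \<in> carrier k" "x \<in> carrier A" "y \<in> carrier B" for s x y
    using bil that by (simp add: bilinear_map_def linear_maps_def)
  have zero: "f \<zero>\<^bsub>A\<^esub> y = \<zero>\<^bsub>C\<^esub>" if y: "y \<in> carrier B" for y
  proof -
    have "f (\<zero>\<^bsub>k\<^esub> \<odot>\<^bsub>A\<^esub> \<zero>\<^bsub>A\<^esub>) y = \<zero>\<^bsub>k\<^esub> \<odot>\<^bsub>C\<^esub> f \<zero>\<^bsub>A\<^esub> y"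
      using bil y unfolding bilinear_map_def linear_maps_def by blast
    then show ?thesis using fC[of "\<zero>\<^bsub>A\<^esub>" y] y by simp
  qed
  let ?F = "\<lambda>i :: nat. (\<lambda>b. (r [^]\<^bsub>k\<^esub> i) \<odot>\<^bsub>B\<^esub> b) ` carrier B"
  have pow: "r [^]\<^bsub>k\<^esub> i \<in> carrier k" for i :: nat using r by simp
  have sub: "submodule (?F i) k B" for i
    by (rule B.submodule_image[OF pow B.carrier_is_submodule])
  have "?F (Suc i) \<subseteq> ?F i" for i
  proof
    fix x assume "x \<in> ?F (Suc i)"
    then obtain b where "b \<in> carrier B" "x = r [^]\<^bsub>k\<^esub> i \<odot>\<^bsub>B\<^esub> (r \<odot>\<^bsub>B\<^esub> b)"
      using r by (auto simp: B.smult_assoc1)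
    then show "x \<in> ?F i" using r by blast
  qed
  then have "\<exists>n. \<forall>m\<ge>n. ?F m = ?F n"
    using art[unfolded artinian_module_def, THEN conjunct2, THEN spec, of ?F] sub by blast
  then obtain n where stable: "\<forall>m\<ge>n. ?F m = ?F n" by (rule exE)
  have n: "?F (Suc n) = ?F n" by (rule stable[rule_format]) simp
  have "\<exists>a'\<in>N. a = r [^]\<^bsub>k\<^esub> i \<odot>\<^bsub>A\<^esub> a'" for i :: nat
  proof (induction i)
    case 0 then show ?case using a NA by (intro bexI[of _ a]) auto
  next
    case (Suc i)
    then obtain a' where a': "a' \<in> N" "a = r [^]\<^bsub>k\<^esub> i \<odot>\<^bsub>A\<^esub> a'" by blast
    then obtain a'' where "a'' \<in> N" "a' = r \<odot>\<^bsub>A\<^esub> a''" using div by blast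
    then show ?case using a' r NA by (intro bexI[of _ a'']) (auto simp: A.smult_assoc1)
  qed
  then obtain a' where a': "a' \<in> N" "a = r [^]\<^bsub>k\<^esub> n \<odot>\<^bsub>A\<^esub> a'" by blast
  have "f a b = \<zero>\<^bsub>C\<^esub>" if b: "b \<in> carrier B" for b
  proof -
    obtain b' where b': "b' \<in> carrier B" "r [^]\<^bsub>k\<^esub> n \<odot>\<^bsub>B\<^esub> b = r [^]\<^bsub>k\<^esub> Suc n \<odot>\<^bsub>B\<^esub> b'"
      using n b by blast
    have "f a b = f a' (r [^]\<^bsub>k\<^esub> n \<odot>\<^bsub>B\<^esub> b)" using a' b pow NA swap by simp
    also have "\<dots> = f a' (r [^]\<^bsub>k\<^esub> n \<odot>\<^bsub>B\<^esub> (r \<odot>\<^bsub>B\<^esub> b'))" using b' r by (simp add: B.smult_assoc1)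
    also have "\<dots> = f a (r \<odot>\<^bsub>B\<^esub> b')" using a' b' r pow NA swap by simp
    also have "\<dots> = f (r \<odot>\<^bsub>A\<^esub> a) b'" using swap[OF r NA[OF a(1)] b'(1)] by (rule sym)
    also have "\<dots> = \<zero>\<^bsub>C\<^esub>" using a b' zero by simp
    finally show ?thesis .
  qed
  then show ?thesis using nondeg a NA by blast
qed

lemma finite_length_of_left_nondegenerate:
  fixes k :: "('r, 'x) ring_scheme"
    and A :: "('r, 'a, 'y) module_scheme"
    and B :: "('r, 'b, 'z) module_scheme"
    and C :: "('r, 'c, 'w) module_scheme"
  assumes "module k C"
    and bil: "bilinear_map k A B C f"
    and nondeg: "\<forall>a\<in>carrier A. a \<noteq> \<zero>\<^bsub>A\<^esub> \<longrightarrow> (\<exists>b\<in>carrier B. f a b \<noteq> \<zero>\<^bsub>C\<^esub>)"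
    and artA: "artinian_module k A" and artB: "artinian_module k B"
  shows "finite_length k A"
proof (rule ccontr)
  interpret A: module k A using artA by (simp add: artinian_module_def)
  assume "\<not> finite_length k A"
  then have "\<not> finite_length_submodule k A (carrier A)" by (simp add: A.finite_length_iff)
  then obtain N where N: "submodule N k A" and infinite: "\<not> finite_length_submodule k A N"
    and minimal: "\<And>K. submodule K k A \<Longrightarrow> K \<subset> N \<Longrightarrow> \<not> \<not> finite_length_submodule k A K"
    by (rule A.artinian_minimal[OF artA A.carrier_is_submodule]) (rule that)
  then have proper: "finite_length_submodule k A K" if "submodule K k A" "K \<subset> N" for K
    using that by simp
  have nz: "N \<noteq> {\<zero>\<^bsub>A\<^esub>}"
    using infinite by (auto simp: finite_length_submodule_def)
  have dich: "\<forall>y\<in>N. r \<odot>\<^bsub>A\<^esub> y = \<zero>\<^bsub>A\<^esub>"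
    if r: "r \<in> carrier k" and x: "x \<in> N" "x \<noteq> \<zero>\<^bsub>A\<^esub>" "r \<odot>\<^bsub>A\<^esub> x = \<zero>\<^bsub>A\<^esub>" for r x
  proof (rule ccontr)
    assume not: "\<not> (\<forall>y\<in>N. r \<odot>\<^bsub>A\<^esub> y = \<zero>\<^bsub>A\<^esub>)"
    have "submodule {x \<in> N. r \<odot>\<^bsub>A\<^esub> x = \<zero>\<^bsub>A\<^esub>} k A"
      using A.submodule_preimage[OF r N A.zero_submodule] by simp
    then have ker: "finite_length_submodule k A {x \<in> N. r \<odot>\<^bsub>A\<^esub> x = \<zero>\<^bsub>A\<^esub>}"
      using proper not by blast
    have "(\<lambda>x. r \<odot>\<^bsub>A\<^esub> x) ` N \<noteq> N"
      using divisible_imp_torsion_free[OF A.module_axioms \<open>module k C\<close> bil nondeg artB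
          A.submoduleE(1)[OF N] r _ x(1,3)] x(2) by blast
    then have "(\<lambda>x. r \<odot>\<^bsub>A\<^esub> x) ` N \<subset> N" using A.submoduleE(4)[OF N r] by blast
    then have "finite_length_submodule k A ((\<lambda>x. r \<odot>\<^bsub>A\<^esub> x) ` N)"
      using proper A.submodule_image[OF r N] by blast
    then show False using infinite ker A.finite_length_from_scaling[OF r N] by blast
  qed
  have field: "\<exists>c\<in>carrier k. \<forall>x\<in>N. c \<odot>\<^bsub>A\<^esub> (r \<odot>\<^bsub>A\<^esub> x) = x"
    if "r \<in> carrier k" "\<not> (\<forall>y\<in>N. r \<odot>\<^bsub>A\<^esub> y = \<zero>\<^bsub>A\<^esub>)" for r
    by (rule A.scalars_act_as_field[OF artA N nz _ that]) (rule dich)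
  obtain K where K: "submodule_cover k A K N"
    by (rule A.exists_maximal_submodule[OF N nz field])
  then have "finite_length_submodule k A K" using proper by (auto simp: submodule_cover_def)
  then show False using A.finite_length_submodule_cover[OF _ K] infinite by blast
qed

theorem theorem1:
  fixes k :: "('r, 'x) ring_scheme"
    and A :: "('r, 'a, 'y) module_scheme"
    and B :: "('r, 'b, 'z) module_scheme"
    and C :: "('r, 'c, 'w) module_scheme"
    and f :: "'a \<Rightarrow> 'b \<Rightarrow> 'c"
  assumes "cring k"
    and "module k A" and "module k B" and "module k C"
    and "bilinear_map k A B C f"
    and "nondegenerate A B C f"
    and "artinian_module k A" and "artinian_module k B"
  shows "finite_length k A \<and> finite_length k B"
proof
  show "finite_length k A"
    using finite_length_of_left_nondegenerate[of k C A B f] assms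
    by (simp add: nondegenerate_def)
  have "bilinear_map k B A C (\<lambda>b a. f a b)"
    using assms(5) by (simp add: bilinear_map_def)
  then show "finite_length k B"
    using finite_length_of_left_nondegenerate[of k C B A "\<lambda>b a. f a b"] assms
    by (simp add: nondegenerate_def)
qed

end
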